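(* For every $\gamma>0$ there exists $M_0$ such that for every integer $M\ge M_0$ there is a sporadic task set ${\bf T}$ with constrained deadlines ($D_i\le T_i$) such that, for each of the two per-processor tests below, the deadline-monotonic partitioning algorithm with $M$ unit-speed processors returns failure on ${\bf T}$ for some fitting strategy (some sequence of choices among processors passing the test), while $\Lambda({\bf T})\le W(0.5)+\gamma$: (i) time-demand analysis: $\tau_k$ can be added to processor $m$ holding ${\bf T}_m$ iff there is $t\in(0,D_k]$ with $C_k+\sum_{\tau_i\in{\bf T}_m}\lceil t/T_i\rceil C_i\le t$; (ii) hyperbolic test: $\big(\frac{C_k+\sum_{\tau_i\in{\bf T}_m,T_i\ge D_k}C_i}{D_k}+1\big)\prod_{\tau_j\in{\bf T}_m,T_j<D_k}(U_j+1)\le2$. In particular, under an arbitrary fitting strategy the speedup factor of the algorithm with either test, as measured against $\Lambda$, is at least $\frac{1}{W(0.5)}\approx2.84306$ when $M$ is sufficiently large.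
   Context: $W$ denotes the Lambert W function: $W(z)$ is the real solution $w\ge0$ of $z=we^{w}$. A sporadic task $\tau_i=(C_i,T_i,D_i)$ has worst-case execution time $C_i>0$, minimum inter-arrival time $T_i>0$ ($T_i=\infty$ allowed, meaning at most one job, with $U_i=0$), relative deadline $D_i>0$; consecutive job releases are at least $T_i$ apart and each job must complete within $D_i$ of its release. $U_i=C_i/T_i$, $\Delta_i=\max\{U_i,C_i/D_i\}$, $\mathrm{dbf}(\tau_i,t)=\max\{0,\lfloor (t-D_i)/T_i\rfloor+1\}\cdot C_i$. For $M$ processors, $$\Lambda({\bf T})=\max\Big\{\sup_{t>0}\frac{\sum_{\tau_i\in{\bf T}}\mathrm{dbf}(\tau_i,t)}{Mt},\ \frac{\sum_{\tau_i\in{\bf T}}U_i}{M},\ \max_{\tau_i\in{\bf T}}\Delta_i\Big\};$$ no multiprocessor scheduling algorithm can schedule ${\bf T}$ on $M$ processors of speed $s<\Lambda({\bf T})$. Deadline-monotonic partitioning algorithm: tasks indexed by non-decreasing relative deadline; ${\bf T}_1=\{\tau_1\}$, ${\bf T}_m=\emptyset$ for $m\ge2$; for $k=2,\dots,N$, if some processor $m$ has ${\bf T}_m\cup\{\tau_k\}$ passing the test, choose one such $m$ by the fitting strategy and add $\tau_k$ to ${\bf T}_m$, else return failure. *)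

theory Defs
  imports Complex_Main "HOL-Library.Extended_Real" "HOL-Library.Multiset"
begin

definition lambert_W :: "real \<Rightarrow> real" where
  "lambert_W z = (THE w. 0 \<le> w \<and> z = w * exp w)"

datatype task = Task (wcet: real) (period: ereal) (deadline: real)

definition sporadic_task :: "task \<Rightarrow> bool" where
  "sporadic_task \<tau> \<longleftrightarrow> 0 < wcet \<tau> \<and> 0 < period \<tau> \<and> 0 < deadline \<tau>"

definition constrained_deadline :: "task \<Rightarrow> bool" where
  "constrained_deadline \<tau> \<longleftrightarrow> ereal (deadline \<tau>) \<le> period \<tau>"

definition util :: "task \<Rightarrow> real" where
  "util \<tau> = (if period \<tau> = \<infinity> then 0 else wcet \<tau> / real_of_ereal (period \<tau>))"

definition density :: "task \<Rightarrow> real" where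
  "density \<tau> = max (util \<tau>) (wcet \<tau> / deadline \<tau>)"

(* A task with infinite period releases a single job: its demand is wcet from the deadline
   on, which is also the value of the formula for every sufficiently large period. *)
definition dbf :: "task \<Rightarrow> real \<Rightarrow> real" where
  "dbf \<tau> t =
    (if period \<tau> = \<infinity> then (if deadline \<tau> \<le> t then wcet \<tau> else 0)
     else real_of_int (max 0 (\<lfloor>(t - deadline \<tau>) / real_of_ereal (period \<tau>)\<rfloor> + 1)) * wcet \<tau>)"

(* The ceiling of t / period for t > 0; an infinite period means one job, released at 0. *)
definition releases :: "task \<Rightarrow> real \<Rightarrow> real" where
  "releases \<tau> t =
    (if period \<tau> = \<infinity> then 1 else real_of_int \<lceil>t / real_of_ereal (period \<tau>)\<rceil>)"

(* Collections of tasks are multisets, as distinct tasks may have the same parameters. *)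
definition Lambda :: "nat \<Rightarrow> task multiset \<Rightarrow> real" where
  "Lambda M TS = Max {SUP t\<in>{0<..}. (\<Sum>\<tau>\<in>#TS. dbf \<tau> t) / (real M * t),
                      (\<Sum>\<tau>\<in>#TS. util \<tau>) / real M,
                      Max (density ` set_mset TS)}"

(* The real-valued supremum in Lambda is over a bounded set, hence is not a default value. *)
lemma Lambda_sup_bdd_above:
  assumes "0 < M" and "\<forall>\<tau>\<in>#TS. sporadic_task \<tau>"
  shows "bdd_above ((\<lambda>t. (\<Sum>\<tau>\<in>#TS. dbf \<tau> t) / (real M * t)) ` {0<..})"
proof -
  have single: "dbf \<tau> t \<le> (util \<tau> + wcet \<tau> / deadline \<tau>) * t"
    if "sporadic_task \<tau>" "0 < t" for \<tau> t
  proof -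
    have pos: "0 < wcet \<tau>" "0 < deadline \<tau>"
      using that by (auto simp: sporadic_task_def)
    show ?thesis
    proof (cases "deadline \<tau> \<le> t")
      case True
      then have 1: "wcet \<tau> \<le> wcet \<tau> / deadline \<tau> * t"
        using pos by (simp add: field_simps)
      show ?thesis
      proof (cases "period \<tau> = \<infinity>")
        case True
        then show ?thesis using 1 \<open>deadline \<tau> \<le> t\<close> by (simp add: dbf_def util_def)
      next
        case False
        define T where "T = real_of_ereal (period \<tau>)"
        have T: "0 < T"
          using False that(1) unfolding T_def sporadic_task_def by (cases "period \<tau>") auto
        let ?k = "\<lfloor>(t - deadline \<tau>) / T\<rfloor>"
        have "0 \<le> ?k" using T True by simp
        have "real_of_int ?k \<le> (t - deadline \<tau>) / T" by (rule of_int_floor_le)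
        also have "\<dots> \<le> t / T" using T pos by (simp add: divide_right_mono)
        finally have "real_of_int ?k * wcet \<tau> \<le> t / T * wcet \<tau>"
          using pos by (intro mult_right_mono) auto
        then show ?thesis
          using 1 False \<open>0 \<le> ?k\<close>
          by (simp add: dbf_def util_def T_def[symmetric] algebra_simps)
      qed
    next
      case False
      have u: "0 \<le> util \<tau>"
        using that(1) by (cases "period \<tau>") (auto simp: util_def sporadic_task_def)
      have "dbf \<tau> t = 0"
      proof (cases "period \<tau> = \<infinity>")
        case True
        then show ?thesis using False by (simp add: dbf_def)
      next
        case fin: False
        have T: "0 < real_of_ereal (period \<tau>)"
          using fin that(1) unfolding sporadic_task_def by (cases "period \<tau>") auto
        then have "(t - deadline \<tau>) / real_of_ereal (period \<tau>) < 0"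
          using False by (simp add: divide_less_0_iff)
        then have "\<lfloor>(t - deadline \<tau>) / real_of_ereal (period \<tau>)\<rfloor> + 1 \<le> 0" by linarith
        then show ?thesis using fin by (simp add: dbf_def)
      qed
      then show ?thesis using u pos that(2) by simp
    qed
  qed
  let ?B = "\<Sum>\<tau>\<in>#TS. util \<tau> + wcet \<tau> / deadline \<tau>"
  have total: "(\<Sum>\<tau>\<in>#TS. dbf \<tau> t) \<le> ?B * t" if "0 < t" for t
    using assms(2)
  proof (induction TS)
    case empty
    then show ?case by simp
  next
    case (add \<tau> TS)
    then show ?case using single[of \<tau> t] that by (simp add: distrib_right)
  qed
  show ?thesis
  proof (rule bdd_aboveI2)
    fix t :: real
    assume "t \<in> {0<..}"
    then show "(\<Sum>\<tau>\<in>#TS. dbf \<tau> t) / (real M * t) \<le> ?B / real M"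
      using total[of t] assms(1) by (simp add: field_simps)
  qed
qed

type_synonym schedulability_test = "task multiset \<Rightarrow> task \<Rightarrow> bool"

definition tda_test :: schedulability_test where
  "tda_test P \<tau> \<longleftrightarrow>
    (\<exists>t. 0 < t \<and> t \<le> deadline \<tau> \<and> wcet \<tau> + (\<Sum>\<sigma>\<in>#P. releases \<sigma> t * wcet \<sigma>) \<le> t)"

definition hyperbolic_test :: schedulability_test where
  "hyperbolic_test P \<tau> \<longleftrightarrow>
    ((wcet \<tau> + (\<Sum>\<sigma>\<in>#{#\<sigma> \<in># P. ereal (deadline \<tau>) \<le> period \<sigma>#}. wcet \<sigma>)) / deadline \<tau> + 1)
      * (\<Prod>\<sigma>\<in>#{#\<sigma> \<in># P. period \<sigma> < ereal (deadline \<tau>)#}. util \<sigma> + 1) \<le> 2"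

type_synonym assignment = "nat \<Rightarrow> task multiset"

(* A fitting strategy picks one of the processors that pass the test, given the current
   assignment. As the assignment strictly grows in a run, every sequence of admissible
   choices is produced by such a function. *)
type_synonym fitting = "assignment \<Rightarrow> task \<Rightarrow> nat set \<Rightarrow> nat"

definition fitting_strategy :: "fitting \<Rightarrow> bool" where
  "fitting_strategy fit \<longleftrightarrow> (\<forall>P \<tau> A. A \<noteq> {} \<longrightarrow> fit P \<tau> A \<in> A)"

(* Processors are 0, ..., M - 1; None means that failure is returned. *)
fun assign_tasks ::
    "schedulability_test \<Rightarrow> nat \<Rightarrow> fitting \<Rightarrow> assignment \<Rightarrow> task list \<Rightarrow> assignment option" where
  "assign_tasks test M fit P [] = Some P"
| "assign_tasks test M fit P (\<tau> # ts) =
    (let A = {m. m < M \<and> test (P m) \<tau>} in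
     if A = {} then None
     else let m = fit P \<tau> A in assign_tasks test M fit (P(m := add_mset \<tau> (P m))) ts)"

(* The first task is put on the first processor without being tested. *)
fun dm_partition ::
    "schedulability_test \<Rightarrow> nat \<Rightarrow> fitting \<Rightarrow> task list \<Rightarrow> assignment option" where
  "dm_partition test M fit [] = Some (\<lambda>m. {#})"
| "dm_partition test M fit (\<tau> # ts) = assign_tasks test M fit ((\<lambda>m. {#})(0 := {#\<tau>#})) ts"

(* A task set together with its indexing by non-decreasing relative deadline. *)
definition dm_indexed_task_set :: "task list \<Rightarrow> bool" where
  "dm_indexed_task_set ts \<longleftrightarrow>
    ts \<noteq> [] \<and> (\<forall>\<tau>\<in>set ts. sporadic_task \<tau> \<and> constrained_deadline \<tau>)
      \<and> sorted (map deadline ts)"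

definition speedup_guarantee :: "schedulability_test \<Rightarrow> nat \<Rightarrow> real \<Rightarrow> bool" where
  "speedup_guarantee test M \<rho> \<longleftrightarrow> 0 < \<rho> \<and>
    (\<forall>ts fit. dm_indexed_task_set ts \<and> fitting_strategy fit \<and> Lambda M (mset ts) \<le> 1 / \<rho>
       \<longrightarrow> dm_partition test M fit ts \<noteq> None)"

(* The least guarantee valid under every fitting strategy, infinity if there is none. *)
definition speedup_factor :: "schedulability_test \<Rightarrow> nat \<Rightarrow> ereal" where
  "speedup_factor test M = (INF \<rho>\<in>{\<rho>. speedup_guarantee test M \<rho>}. ereal \<rho>)"

end

theory Submission
  imports Defs
begin

text \<open>
  Put w = W(1/2), so that a = 2w = exp (- w). Give every processor many tiny implicit-deadline
  tasks with execution time d and periods a + d, a + 2d, ..., 1 - d, and one single-job task with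
  execution time 3w - 1 and deadline 1; the last task has execution time w + g and deadline 1.
  For a \<le> t \<le> 1 the tiny tasks demand about (1 - a) + (t - a), so the total demand is about
  t + g (and about a + g for t < a), and the last task fits on no processor. Likewise the hyperbolic product is about
  4w / a = 2 in the limit. The tiny tasks have utilization about - ln a = w per processor, and
  their demand plus 3w - 1 is at most w t for every t \<ge> 1, with equality in the limit at t = 1.
\<close>

section \<open>Enclosing W(1/2)\<close>

lemma lambert_W_eqI:
  assumes "0 \<le> w" "z = w * exp w"
  shows "lambert_W z = w"
  unfolding lambert_W_def
proof (rule the_equality)
  fix v :: real
  assume v: "0 \<le> v \<and> z = v * exp v"
  have *: "x * exp x < y * exp y" if "0 \<le> x" "x < y" for x y :: real
    using that by (intro mult_strict_mono) auto
  show "v = w" using *[of v w] *[of w v] v assms by (metis less_irrefl not_less_iff_gr_or_eq)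
qed (use assms in auto)

text \<open>The Lagrange remainder has a factor \<open>exp t\<close> with t < 1, hence at most 3.
  Near x = 0.352 it is below 2e-8, whereas \<open>w * exp w\<close> differs from 1/2 by more than
  1e-6 at either end of the enclosure of W(1/2) below.\<close>

lemma exp_le_Taylor:
  fixes x :: real
  assumes "0 < x" "x \<le> 1"
  shows "exp x \<le> (\<Sum>m<8. x ^ m / fact m) + 3 / fact 8 * x ^ 8"
proof -
  obtain t where t: "\<bar>t\<bar> < \<bar>x\<bar>" "exp x = (\<Sum>m<8. x ^ m / fact m) + exp t / fact 8 * x ^ 8"
    using Maclaurin_exp_lt[of x 8] assms by auto
  have "exp t \<le> exp 1" using t assms by simp
  also have "\<dots> \<le> 3" using exp_le by simp
  finally show ?thesis
    unfolding t(2) using assms by (intro add_left_mono mult_right_mono divide_right_mono) auto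
qed

lemma Taylor_le_exp:
  fixes x :: real
  assumes "0 < x"
  shows "(\<Sum>m<8. x ^ m / fact m) \<le> exp x"
proof -
  obtain t where t: "exp x = (\<Sum>m<8. x ^ m / fact m) + exp t / fact 8 * x ^ 8"
    using Maclaurin_exp_lt[of x 8] assms by auto
  show ?thesis unfolding t using assms by simp
qed

text \<open>The end points are the reciprocals of 2.84306 +- 0.000005, the tolerance for 1 / W(1/2).
  The Taylor bounds give opposite signs at the two ends, and the intermediate value theorem yields
  w.\<close>

lemma lambert_W_half_bounds:
  obtains w where "lambert_W (1 / 2) = w" "w * exp w = 1 / 2"
    "1 / 2.843065 \<le> w" "w \<le> 1 / 2.843055"
proof -
  have lo: "1 / 2.843065 * exp (1 / 2.843065) \<le> (1 / 2 :: real)"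
    by (rule order_trans[OF mult_left_mono[OF exp_le_Taylor]])
      (simp_all add: eval_nat_numeral fact_numeral field_simps)
  have hi: "(1 / 2 :: real) \<le> 1 / 2.843055 * exp (1 / 2.843055)"
    by (rule order_trans[OF _ mult_left_mono[OF Taylor_le_exp]])
      (simp_all add: eval_nat_numeral fact_numeral field_simps)
  obtain w :: real where w: "1 / 2.843065 \<le> w" "w \<le> 1 / 2.843055" "w * exp w = 1 / 2"
    using IVT[of "\<lambda>w. w * exp w", OF lo hi] by auto
  moreover have "lambert_W (1 / 2) = w"
    using w by (intro lambert_W_eqI) auto
  ultimately show ?thesis using that by blast
qed

section \<open>Harmonic sums and the limiting demand\<close>

text \<open>Midpoint rule for the convex function 1/u on [x - 1/2, x + 1/2]. With h = 1/(2x) it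
  reads 2h <= ln ((1 + h) / (1 - h)), shown by a derivative in h.\<close>

lemma inverse_le_ln_midpoint:
  fixes x :: real
  assumes "1 \<le> x"
  shows "1 / x \<le> ln ((x + 1 / 2) / (x - 1 / 2))"
proof -
  define h :: real where "h = 1 / (2 * x)"
  have h: "0 \<le> h" "h < 1" "h \<le> 1 / 2" using assms by (auto simp: h_def field_simps)
  define f where "f = (\<lambda>u::real. ln (1 + u) - ln (1 - u) - 2 * u)"
  have "f 0 \<le> f h"
  proof (rule DERIV_nonneg_imp_nondecreasing[of 0 h f])
    fix u assume u: "0 \<le> u" "u \<le> h"
    then have u1: "u < 1" using h by auto
    have uu: "u * u < 1" using u u1 mult_mono[of u 1 u u] by simp
    have "(f has_real_derivative (1 / (1 + u) + 1 / (1 - u) - 2)) (at u)"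
      unfolding f_def using u u1 by (auto intro!: derivative_eq_intros)
    moreover have "1 / (1 + u) + 1 / (1 - u) - 2 = 2 * (u * u) / (1 - u * u)"
      using u u1 uu by (simp add: field_simps)
    moreover have "0 \<le> 2 * (u * u) / (1 - u * u)" using uu by simp
    ultimately show "\<exists>y. (f has_real_derivative y) (at u) \<and> 0 \<le> y" by auto
  qed (use h in auto)
  moreover have "(x + 1 / 2) / (x - 1 / 2) = (1 + h) / (1 - h)"
    using assms by (simp add: h_def field_simps)
  moreover have "1 / x = 2 * h" by (simp add: h_def)
  ultimately show ?thesis using h by (simp add: f_def ln_div)
qed

lemma sum_inverse_le_ln:
  assumes "n \<le> m"
  shows "(\<Sum>k = Suc n..m. 1 / real k) \<le> ln ((m + 1 / 2) / (n + 1 / 2))"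
  using assms
proof (induction m rule: dec_induct)
  case (step m)
  have "(\<Sum>k = Suc n..Suc m. 1 / real k) = (\<Sum>k = Suc n..m. 1 / real k) + 1 / real (Suc m)"
    using step by simp
  also have "\<dots> \<le> ln ((m + 1 / 2) / (n + 1 / 2)) + ln ((m + 3 / 2) / (m + 1 / 2))"
    using step.IH inverse_le_ln_midpoint[of "real (Suc m)"] by (simp add: algebra_simps)
  also have "\<dots> = ln ((Suc m + 1 / 2) / (n + 1 / 2))"
    by (simp add: ln_div algebra_simps)
  finally show ?case .
qed simp

text \<open>The sum over k is the integral of \<lfloor>t / s\<rfloor> over s from a to 1; the left-hand side is a
  Riemann sum of it at right end points, and \<lfloor>t / s\<rfloor> is antitone in s.\<close>
lemma sum_floor_le_sum_min:
  fixes a d t :: real and N :: nat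
  assumes "0 < a" "0 \<le> d" "0 \<le> t" "a + real N * d \<le> 1"
  shows "(\<Sum>j = 1..N. d * \<lfloor>t / (a + real j * d)\<rfloor>) \<le> (\<Sum>k = 1..nat \<lfloor>t / a\<rfloor>. min 1 (t / real k) - a)"
proof -
  define m where "m = nat \<lfloor>t / a\<rfloor>"
  \<comment> \<open>an antiderivative of \<lfloor>t / s\<rfloor> on s \<ge> a\<close>
  define \<Phi> where "\<Phi> = (\<lambda>s. \<Sum>k = 1..m. min s (t / real k))"
  have step: "d * \<lfloor>t / s\<rfloor> \<le> \<Phi> s - \<Phi> (s - d)" if "a \<le> s" for s
  proof -
    have s: "0 < s" using that assms by simp
    define q where "q = nat \<lfloor>t / s\<rfloor>"
    have q: "real q = \<lfloor>t / s\<rfloor>" using s assms by (simp add: q_def)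
    have "q \<le> m"
      unfolding q_def m_def using that assms by (intro nat_mono floor_mono) (auto intro: divide_left_mono)
    have "d * \<lfloor>t / s\<rfloor> = (\<Sum>k = 1..q. d)" by (simp flip: q)
    \<comment> \<open>For k <= q = \<lfloor>t / s\<rfloor> we have s <= t / k, so the minimum grows
      by the full d; the terms with k > q added next are nonnegative.\<close>
    also have "\<dots> \<le> (\<Sum>k = 1..q. min s (t / real k) - min (s - d) (t / real k))"
    proof (rule sum_mono)
      fix k assume "k \<in> {1..q}"
      then have k: "1 \<le> k" "k \<le> q" by auto
      have "real k \<le> t / s" using k q of_int_floor_le[of "t / s"] by linarith
      then have "s \<le> t / k" using s k by (simp add: field_simps)
      then show "d \<le> min s (t / real k) - min (s - d) (t / real k)" using assms by simp
    qed
    also have "\<dots> \<le> (\<Sum>k = 1..m. min s (t / real k) - min (s - d) (t / real k))"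
      using \<open>q \<le> m\<close> assms by (intro sum_mono2) auto
    finally show ?thesis by (simp add: \<Phi>_def sum_subtractf)
  qed
  have "(\<Sum>j = 1..N. d * \<lfloor>t / (a + real j * d)\<rfloor>) \<le> (\<Sum>j = 1..N. \<Phi> (a + real j * d) - \<Phi> (a + real (j - 1) * d))"
  proof (rule sum_mono)
    fix j assume j: "j \<in> {1..N}"
    have p: "a + real (j - 1) * d = a + real j * d - d" using j by (simp add: of_nat_diff algebra_simps)
    show "d * \<lfloor>t / (a + real j * d)\<rfloor> \<le> \<Phi> (a + real j * d) - \<Phi> (a + real (j - 1) * d)"
      unfolding p using assms by (intro step) simp
  qed
  also have "\<dots> = \<Phi> (a + real N * d) - \<Phi> a"
    by (induction N) (simp_all add: algebra_simps)
  also have "\<dots> \<le> \<Phi> 1 - \<Phi> a"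
    unfolding \<Phi>_def using assms by (intro diff_right_mono sum_mono) auto
  also have "\<Phi> a = (\<Sum>k = 1..m. a)"
    unfolding \<Phi>_def
  proof (rule sum.cong)
    fix k assume k: "k \<in> {1..m}"
    have "real k \<le> t / a"
      using k assms of_int_floor_le[of "t / a"] unfolding m_def by (auto simp: le_nat_iff) linarith
    then show "min a (t / real k) = a" using k assms by (simp add: field_simps)
  qed simp
  finally show ?thesis by (simp add: \<Phi>_def m_def sum_subtractf)
qed

text \<open>The left-hand side is the limit, as d tends to 0, of the demand on one processor. At t =
  1 it is (1 - 2w) + (3w - 1) = w, so there is no slack there. Terms with k <= \<lfloor>t\<rfloor>
  equal 1 - 2w and the later ones t / k - 2w, which leaves a piece of the harmonic sum.\<close>

lemma sum_min_le_linear: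
  fixes t w :: real
  assumes w: "w * exp w = 1 / 2" "0.3517 \<le> w" "w \<le> 0.3518" and t: "0 < t"
  shows "(\<Sum>k = 1..nat \<lfloor>t / (2 * w)\<rfloor>. min 1 (t / real k) - 2 * w) + (if 1 \<le> t then 3 * w - 1 else 0) \<le> w * t"
proof -
  define a where "a = 2 * w"
  have a: "0.7034 \<le> a" "a \<le> 0.7036" using w by (auto simp: a_def)
  define n where "n = nat \<lfloor>t\<rfloor>"
  define m where "m = nat \<lfloor>t / a\<rfloor>"
  have "real n = \<lfloor>t\<rfloor>" using t by (simp add: n_def)
  then have n: "real n \<le> t" "t < n + 1" by linarith+
  have "real m = \<lfloor>t / a\<rfloor>" using t a by (simp add: m_def)
  then have m: "real m \<le> t / a" "t / a < m + 1" by linarith+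
  have m': "real m * a \<le> t" "t < (m + 1) * a" using m a by (auto simp: field_simps)
  \<comment> \<open>Naming the product makes the cases n < 3 linear in t, w and p. The numerical
    bound \<open>wt\<close> suffices except for n = m = 1, where equality at t = 1 requires the
    exact \<open>wp\<close>.\<close>
  define p where "p = w * t"
  have wt: "0.3517 * t \<le> p" unfolding p_def using w t by (intro mult_right_mono) auto
  have wp: "w \<le> p" if "1 \<le> t" using that w by (simp add: p_def)
  have "n \<le> m"
    unfolding n_def m_def using a t by (intro nat_mono floor_mono) (auto simp: field_simps)
  have "(\<Sum>k = 1..m. min 1 (t / real k)) = (\<Sum>k = 1..n. min 1 (t / real k)) + (\<Sum>k = Suc n..m. min 1 (t / real k))"
    using sum.ub_add_nat[of 1 n "\<lambda>k. min 1 (t / real k)" "m - n"] \<open>n \<le> m\<close> by simp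
  also have "(\<Sum>k = 1..n. min 1 (t / real k)) = (\<Sum>k = 1..n. 1)"
    using n by (intro sum.cong) auto
  also have "(\<Sum>k = Suc n..m. min 1 (t / real k)) = (\<Sum>k = Suc n..m. t * (1 / real k))"
    using n by (intro sum.cong) (auto simp: min_def field_simps)
  finally have sum: "(\<Sum>k = 1..m. min 1 (t / real k) - a) = n - m * a + t * (\<Sum>k = Suc n..m. 1 / real k)"
    by (simp add: sum_subtractf sum_distrib_left)
  have ranges: "{Suc (Suc 0)..2} = {2}" "{3..4::nat} = {3, 4}"
    by auto
  \<comment> \<open>The midpoint estimate of case 4 is too weak for n < 3; there m \<le> 4, and the claim is linear in t.\<close>
  consider "n = 0" | "n = 1" | "n = 2" | "3 \<le> n" by linarith
  then have "n - m * a + t * (\<Sum>k = Suc n..m. 1 / real k) + (if 1 \<le> t then 3 * w - 1 else 0) \<le> w * t"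
  proof cases
    case 1
    \<comment> \<open>As a > 0.7, here 2a > 1 > t; in the next two cases 3a > 2 and 5a > 3 limit m
      likewise.\<close>
    have "m \<le> 1"
    proof (rule ccontr)
      assume "\<not> m \<le> 1"
      then have "2 * a \<le> real m * a" using a by (intro mult_right_mono) auto
      then show False using 1 n m' a by simp
    qed
    then have "m = 0 \<or> m = 1" by linarith
    then show ?thesis unfolding p_def[symmetric] using 1 n m' w(2,3) wt t a by (auto simp: a_def)
  next
    case 2
    have "m \<le> 2"
    proof (rule ccontr)
      assume "\<not> m \<le> 2"
      then have "3 * a \<le> real m * a" using a by (intro mult_right_mono) auto
      then show False using 2 n m' a by simp
    qed
    then have "m = 1 \<or> m = 2" using \<open>n \<le> m\<close> 2 by linarith
    then show ?thesis unfolding p_def[symmetric] using 2 n m' w(2,3) wt wp t a by (auto simp: a_def ranges)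
  next
    case 3
    have "m \<le> 4"
    proof (rule ccontr)
      assume "\<not> m \<le> 4"
      then have "5 * a \<le> real m * a" using a by (intro mult_right_mono) auto
      then show False using 3 n m' a by simp
    qed
    then have "m = 2 \<or> m = 3 \<or> m = 4" using \<open>n \<le> m\<close> 3 by linarith
    then show ?thesis unfolding p_def[symmetric] using 3 n m' w(2,3) wt t a by (auto simp: a_def ranges)
  next
    case 4
    define S where "S = (\<Sum>k = Suc n..m. 1 / real k)"
    have "ln a = - w"
    proof -
      have "a = exp (- w)" using w by (simp add: a_def exp_minus field_simps)
      then show ?thesis by simp
    qed
    \<comment> \<open>Writing w = - ln a this way pairs ln (m + 1/2) with ln (t / a) and ln (n +
      1/2) with ln t. The arguments in each pair are close, so ln x <= x - 1 loses little.\<close>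
    then have "w = ln (t / a) - ln t" using a t by (simp add: ln_div)
    moreover have "S \<le> ln (m + 1 / 2) - ln (n + 1 / 2)"
      using sum_inverse_le_ln[OF \<open>n \<le> m\<close>] by (simp add: S_def ln_div)
    moreover have "ln (m + 1 / 2) - ln (t / a) \<le> (m + 1 / 2) / (t / a) - 1"
      using ln_le_minus_one[of "(m + 1 / 2) / (t / a)"] a t by (simp add: ln_div ln_mult)
    moreover have "ln t - ln (n + 1 / 2) \<le> t / (n + 1 / 2) - 1"
      using ln_le_minus_one[of "t / (n + 1 / 2)"] t by (simp add: ln_div)
    ultimately have "S - w \<le> (m + 1 / 2) / (t / a) + t / (n + 1 / 2) - 2" by linarith
    then have "t * (S - w) \<le> t * ((m + 1 / 2) / (t / a) + t / (n + 1 / 2) - 2)"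
      using t by (intro mult_left_mono) auto
    also have "\<dots> = t * ((m + 1 / 2) / (t / a)) + t * t / (n + 1 / 2) - 2 * t"
      by (simp add: right_diff_distrib distrib_left)
    also have "t * ((m + 1 / 2) / (t / a)) = (m + 1 / 2) * a"
      using t by simp
    \<comment> \<open>Expanding around the midpoint of [n, n + 1] cancels 2t and leaves an error of
      at most (1/4) / (n + 1/2).\<close>
    also have "t * t / (n + 1 / 2) = 2 * t - (n + 1 / 2) + (t - (n + 1 / 2))\<^sup>2 / (n + 1 / 2)"
    proof -
      have "t * t / c = 2 * t - c + (t - c)\<^sup>2 / c" if "0 < c" for c
        using that by (simp add: field_simps power2_eq_square)
      then show ?thesis by simp
    qed
    finally have 1: "t * (S - w) \<le> m * a - n + (a - 1) / 2 + (t - (n + 1 / 2))\<^sup>2 / (n + 1 / 2)"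
      by (simp add: distrib_right diff_divide_distrib)
    have "\<bar>t - (n + 1 / 2)\<bar> \<le> \<bar>1 / 2\<bar>"
      unfolding abs_if using n by auto
    then have "(t - (n + 1 / 2))\<^sup>2 \<le> (1 / 2)\<^sup>2"
      by (simp only: abs_le_square_iff)
    then have "(t - (n + 1 / 2))\<^sup>2 / (n + 1 / 2) \<le> (1 / 2)\<^sup>2 / (3 + 1 / 2)"
      using 4 by (intro frac_le) auto
    also have "(1 / 2)\<^sup>2 / (3 + 1 / 2) = (1 / 14 :: real)"
      by (simp add: power2_eq_square)
    finally have "t * S - t * w \<le> m * a - n + (a - 1) / 2 + 1 / 14"
      using 1 by (simp only: right_diff_distrib)
    moreover have "1 \<le> t" using n 4 by linarith
    \<comment> \<open>Equivalent to w <= 5/14. With n = 2 the error 1/10 would require w <= 0.35,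
      which is false.\<close>
    moreover have "(a - 1) / 2 + 1 / 14 \<le> 1 - 3 * w"
      using w(3) by (simp add: a_def field_simps)
    ultimately have "n - m * a + t * S + (3 * w - 1) \<le> t * w"
      by linarith
    with \<open>1 \<le> t\<close> show ?thesis
      unfolding S_def[symmetric] by (simp add: mult.commute)
  qed
  then show ?thesis unfolding sum[symmetric] by (simp add: a_def m_def)
qed

section \<open>Runs that load all processors equally\<close>

text \<open>M consecutive copies of a task are spread over the M processors, one on each.\<close>
definition spread_fit :: fitting where
  "spread_fit P \<tau> A =
    (if \<exists>m\<in>A. \<tau> \<notin># P m then LEAST m. m \<in> A \<and> \<tau> \<notin># P m else SOME m. m \<in> A)"

lemma fitting_strategy_spread_fit: "fitting_strategy spread_fit"
  unfolding fitting_strategy_def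
proof (intro allI impI)
  fix P \<tau> and A :: "nat set"
  assume "A \<noteq> {}"
  show "spread_fit P \<tau> A \<in> A"
  proof (cases "\<exists>m\<in>A. \<tau> \<notin># P m")
    case True
    then have "\<exists>m. m \<in> A \<and> \<tau> \<notin># P m" by blast
    from LeastI_ex[OF this] show ?thesis using True by (simp add: spread_fit_def)
  next
    case False
    then show ?thesis using \<open>A \<noteq> {}\<close> by (auto simp: spread_fit_def some_in_eq)
  qed
qed

lemma assign_tasks_append:
  "assign_tasks test M fit P (xs @ ys) =
    Option.bind (assign_tasks test M fit P xs) (\<lambda>P'. assign_tasks test M fit P' ys)"
  by (induction xs arbitrary: P) (auto simp: Let_def)

text \<open>Stated for a round in progress, with i processors served and k copies left, so that
  induction on k applies. Processors below i may still pass the test but already hold the task,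
  hence i is the least one without it.\<close>

lemma assign_tasks_round:
  assumes "test Q \<tau>" "\<tau> \<notin># Q" "i + k = M"
  shows "assign_tasks test M spread_fit
      (\<lambda>m. if m < i then add_mset \<tau> Q else if m < M then Q else {#}) (replicate k \<tau>) =
    Some (\<lambda>m. if m < M then add_mset \<tau> Q else {#})"
  using assms(3)
proof (induction k arbitrary: i)
  case 0
  then show ?case by (auto intro!: ext)
next
  case (Suc k)
  let ?P = "\<lambda>m. if m < i then add_mset \<tau> Q else if m < M then Q else {#}"
  let ?A = "{m. m < M \<and> test (?P m) \<tau>}"
  have i: "i \<in> ?A" "\<tau> \<notin># ?P i" using Suc.prems assms by auto
  have "(LEAST m. m \<in> ?A \<and> \<tau> \<notin># ?P m) = i"
    using i by (intro Least_equality) (auto simp: not_less[symmetric])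
  then have fit: "spread_fit ?P \<tau> ?A = i" unfolding spread_fit_def using i by auto
  have "?P(i := add_mset \<tau> (?P i)) =
      (\<lambda>m. if m < Suc i then add_mset \<tau> Q else if m < M then Q else {#})"
    using Suc.prems by (auto simp: less_Suc_eq)
  moreover have "?A \<noteq> {}" using i by blast
  ultimately show ?case using Suc.IH[of "Suc i"] Suc.prems fit by (simp add: Let_def)
qed

text \<open>Copies of one task are adjacent, which preserves the deadline order and makes each round
  end with equal processors.\<close>

definition copies :: "nat \<Rightarrow> task list \<Rightarrow> task list" where
  "copies M us = concat (map (replicate M) us)"

text \<open>All processors agree after each round, so the run reduces to testing each task against
  the prefix before it. Distinctness makes the task of a round new to every processor.\<close>

lemma assign_tasks_copies:
  assumes "\<And>k. k < length us \<Longrightarrow> test (mset (take k us)) (us ! k)" "distinct us"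
  shows "assign_tasks test M spread_fit (\<lambda>m. {#}) (copies M us) =
    Some (\<lambda>m. if m < M then mset us else {#})"
  using assms
proof (induction us rule: rev_induct)
  case Nil
  then show ?case by (auto simp: copies_def fun_eq_iff)
next
  case (snoc u us)
  have "test (mset us) u" using snoc.prems(1)[of "length us"] by simp
  moreover have "test (mset (take k us)) (us ! k)" if "k < length us" for k
    using snoc.prems(1)[of k] that by (simp add: nth_append)
  ultimately show ?case
    using snoc.IH snoc.prems(2) assign_tasks_round[of test "mset us" u 0 M M]
    by (simp add: copies_def assign_tasks_append cong: if_cong)
qed

lemma dm_partition_copies_fails:
  assumes pass: "\<And>k. k < length us \<Longrightarrow> test (mset (take k us)) (us ! k)"
    and "distinct us" "us \<noteq> []" "0 < M" and fail: "\<not> test (mset us) \<tau>"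
  shows "dm_partition test M spread_fit (copies M us @ [\<tau>]) = None"
proof -
  obtain u vs where us: "us = u # vs" using assms by (cases us) auto
  obtain M' where M: "M = Suc M'" using assms by (cases M) auto
  obtain xs where xs: "copies M us @ [\<tau>] = u # xs" by (simp add: us M copies_def)
  have "{m. m < M \<and> test {#} u} = {..<M}" using pass[of 0] us by auto
  moreover have "spread_fit (\<lambda>m. {#}) u {..<M} = 0"
    using \<open>0 < M\<close> by (auto simp: spread_fit_def intro!: Least_equality)
  \<comment> \<open>The untested placement of the first task on processor 0 is also what
    \<open>spread_fit\<close> chooses on empty processors.\<close>
  ultimately have "dm_partition test M spread_fit (u # xs) =
      assign_tasks test M spread_fit (\<lambda>m. {#}) (u # xs)"
    using \<open>0 < M\<close> by (auto simp: Let_def lessThan_empty_iff)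
  also have "\<dots> = None"
    unfolding xs[symmetric] assign_tasks_append
    using assign_tasks_copies[of us test M] pass assms fail by (simp add: Let_def)
  finally show ?thesis by (simp add: xs)
qed

lemma set_copies: "0 < M \<Longrightarrow> set (copies M us) = set us"
  by (auto simp: copies_def)

lemma sorted_map_copies: "sorted (map f us) \<Longrightarrow> sorted (map f (copies M us))"
  by (induction us) (auto simp: copies_def sorted_append sorted_replicate)

lemma sum_mset_copies: "(\<Sum>\<tau>\<in>#mset (copies M us). f \<tau>) = real M * (\<Sum>\<tau>\<leftarrow>us. f \<tau>)"
  by (induction us) (auto simp: copies_def sum_mset_replicate_mset distrib_left)

text \<open>A failing task set refutes every guarantee \<rho> with r <= 1 / \<rho>. If there is no
  guarantee at all, the infimum is infinity and the bound still holds.\<close>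

lemma speedup_factor_ge:
  assumes "0 < r" "dm_indexed_task_set ts" "fitting_strategy fit"
    "dm_partition test M fit ts = None" "Lambda M (mset ts) \<le> r"
  shows "ereal (1 / r) \<le> speedup_factor test M"
  unfolding speedup_factor_def
proof (rule INF_greatest)
  fix \<rho> assume "\<rho> \<in> {\<rho>. speedup_guarantee test M \<rho>}"
  then have \<rho>: "0 < \<rho>"
    and guarantee: "\<And>ts fit. dm_indexed_task_set ts \<and> fitting_strategy fit \<and>
      Lambda M (mset ts) \<le> 1 / \<rho> \<Longrightarrow> dm_partition test M fit ts \<noteq> None"
    unfolding speedup_guarantee_def by simp_all
  have "\<not> Lambda M (mset ts) \<le> 1 / \<rho>"
    using guarantee[of ts fit] assms(2-4) by auto
  then have "1 / \<rho> < r" using assms by linarith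
  then show "ereal (1 / r) \<le> ereal \<rho>" using \<rho> assms by (simp add: field_simps)
qed

section \<open>The hard instance\<close>

text \<open>The interval [2w, 1] is cut into N + 1 steps of length d. The excess g of the last task
  is also the margin granted to \<open>Lambda\<close>; both failing tests come down to exactly 2d <
  g.\<close>

locale hard_instance =
  fixes w d g :: real and N :: nat
  assumes w: "w * exp w = 1 / 2" "0.3517 \<le> w" "w \<le> 0.3518"
    and d: "0 < d" "2 * w + (real N + 1) * d = 1" "2 * d < g"
begin

text \<open>Tasks use the indices 1 to N; the values 2w at 0 and 1 at N + 1 are the ends of
  telescoping sums and products.\<close>

definition short_period :: "nat \<Rightarrow> real" where
  "short_period j = 2 * w + j * d"

definition short_task :: "nat \<Rightarrow> task" where
  "short_task j = Task d (ereal (short_period j)) (short_period j)"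

definition filler :: task where
  "filler = Task (3 * w - 1) \<infinity> 1"

definition last_task :: task where
  "last_task = Task (w + g) \<infinity> 1"

definition short_tasks :: "nat \<Rightarrow> task list" where
  "short_tasks k = map short_task [1..<Suc k]"

definition load :: "task list" where
  "load = short_tasks N @ [filler]"

lemma short_period_pos: "0 < short_period j"
  using w d by (simp add: short_period_def add_pos_nonneg)

lemma d_mult_le:
  assumes "k \<le> N"
  shows "k * d + d \<le> 1 - 2 * w"
proof -
  have "real k * d \<le> real N * d" using assms d by (intro mult_right_mono) auto
  moreover have "real N * d + d = 1 - 2 * w" using d by (simp add: algebra_simps)
  ultimately show ?thesis by linarith
qed

lemma short_period_bounds:
  assumes "j \<le> N"
  shows "0.7034 \<le> short_period j" "short_period j < 1"
proof -
  have "0 \<le> j * d" using d by simp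
  then show "0.7034 \<le> short_period j" "short_period j < 1"
    using w d d_mult_le[OF assms] unfolding short_period_def by linarith+
qed

lemma short_periods_less_1: "\<forall>j\<le>N. short_period j < 1"
  using short_period_bounds by blast

lemma sum_short_tasks: "(\<Sum>\<tau>\<in>#mset (short_tasks k). f \<tau>) = (\<Sum>j = 1..k. f (short_task j))"
  by (induction k) (simp_all add: short_tasks_def add.commute)

lemma sum_load: "(\<Sum>\<tau>\<in>#mset load. f \<tau>) = (\<Sum>j = 1..N. f (short_task j)) + f filler"
  by (simp add: load_def sum_short_tasks add.commute)

lemma load_cases:
  assumes "k < length load"
  obtains "k < N" "mset (take k load) = mset (short_tasks k)" "load ! k = short_task (Suc k)"
  | "k = N" "mset (take k load) = mset (short_tasks N)" "load ! k = filler"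
proof (cases "k < N")
  case True
  then show ?thesis using that(1)
    by (simp add: load_def short_tasks_def nth_append take_map take_upt del: upt_Suc)
next
  case False
  then have "k = N" using assms by (simp add: load_def short_tasks_def del: upt_Suc)
  then show ?thesis using that(2) by (simp add: load_def short_tasks_def nth_append del: upt_Suc)
qed

lemma distinct_load: "distinct load"
proof -
  have "inj short_task"
    using d by (auto intro!: injI simp: short_task_def short_period_def)
  then show ?thesis
    by (auto simp: load_def short_tasks_def distinct_map filler_def short_task_def inj_on_def simp del: upt_Suc)
qed

section \<open>Time-demand analysis\<close>

text \<open>All short periods exceed 1/2, so at most two jobs of each task are released before t <=
  1.\<close>

lemma tda_sum_le:
  assumes "k \<le> N" "0 < t" "t \<le> 1"
  shows "(\<Sum>\<sigma>\<in>#mset (short_tasks k). releases \<sigma> t * wcet \<sigma>) \<le> 2 * k * d"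
proof -
  have "(\<Sum>j = 1..k. releases (short_task j) t * d) \<le> (\<Sum>j = 1..k. 2 * d)"
  proof (intro sum_mono mult_right_mono)
    fix j assume "j \<in> {1..k}"
    then have "t / short_period j \<le> 2"
      using short_period_bounds[of j] assms by (simp add: field_simps)
    then show "releases (short_task j) t \<le> 2"
      by (simp add: releases_def short_task_def ceiling_le_iff)
  qed (use d in simp)
  then show ?thesis by (simp add: sum_short_tasks) (simp add: short_task_def)
qed

text \<open>The witness is the deadline of the added task: for a short task the demand is at most 2
  (1 - 2w) < 0.6, below every short deadline, and for the filler it is at most 1 - w.\<close>

lemma tda_pass:
  assumes "k < length load"
  shows "tda_test (mset (take k load)) (load ! k)"
  using assms
proof (cases rule: load_cases)
  case 1
  have "d + 2 * k * d \<le> short_period (Suc k)"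
    using d_mult_le[of k] 1 w d by (simp add: short_period_def algebra_simps)
  moreover have "(\<Sum>\<sigma>\<in>#mset (short_tasks k). releases \<sigma> (short_period (Suc k)) * wcet \<sigma>) \<le> 2 * real k * d"
    using 1 short_period_bounds[of "Suc k"] short_period_pos by (intro tda_sum_le) auto
  ultimately have "d + (\<Sum>\<sigma>\<in>#mset (short_tasks k). releases \<sigma> (short_period (Suc k)) * wcet \<sigma>)
      \<le> short_period (Suc k)" by linarith
  then show ?thesis
    unfolding 1(2,3) tda_test_def
    using short_period_pos by (intro exI[of _ "short_period (Suc k)"]) (auto simp: short_task_def)
next
  case 2
  have "3 * w - 1 + (\<Sum>\<sigma>\<in>#mset (short_tasks N). releases \<sigma> 1 * wcet \<sigma>) \<le> 1"
    using tda_sum_le[of N 1] d_mult_le[of N] w d by simp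
  then show ?thesis
    unfolding 2(2,3) tda_test_def by (intro exI[of _ 1]) (auto simp: filler_def)
qed

text \<open>The grid points a + j d below t belong to the tasks with a second release before t. The
  hypothesis lets the grid reach t, so counting them loses at most one step d.\<close>

lemma sum_second_releases_ge:
  assumes "t \<le> a + (real n + 1) * d"
  shows "t - a - d \<le> (\<Sum>j = 1..n. if a + real j * d < t then d else 0)"
  using assms
proof (induction n)
  case (Suc n)
  show ?case
  proof (cases "t \<le> a + (real n + 1) * d")
    case True
    then show ?thesis using Suc.IH d by simp
  next
    case False
    have "(\<Sum>j = 1..Suc n. if a + real j * d < t then d else 0) = (\<Sum>j = 1..Suc n. d)"
    proof (rule sum.cong)
      fix j assume "j \<in> {1..Suc n}"
      then have "real j * d \<le> (real n + 1) * d" using d by (intro mult_right_mono) auto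
      then show "(if a + real j * d < t then d else 0) = d" using False by simp
    qed simp
    then show ?thesis using Suc.prems by (simp add: algebra_simps)
  qed
qed (use assms in auto)

lemma tda_fail: "\<not> tda_test (mset load) last_task"
proof
  assume "tda_test (mset load) last_task"
  then obtain t where t: "0 < t" "t \<le> 1"
    "w + g + (\<Sum>\<sigma>\<in>#mset load. releases \<sigma> t * wcet \<sigma>) \<le> t"
    unfolding tda_test_def last_task_def by auto
  \<comment> \<open>The first releases give N d = 1 - 2w - d. With the filler and the last task the
    demand is at least t + g - 2d > t; for t < 2w the second summand is negative, so no case
    distinction on t arises.\<close>
  have "real N * d + (t - 2 * w - d) \<le>
      (\<Sum>j = 1..N. d + (if 2 * w + real j * d < t then d else 0))"
    using sum_second_releases_ge[of t "2 * w" N] t d by (simp add: sum.distrib)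
  also have "\<dots> \<le> (\<Sum>j = 1..N. releases (short_task j) t * d)"
  proof (rule sum_mono)
    fix j assume "j \<in> {1..N}"
    have "1 \<le> \<lceil>t / short_period j\<rceil>" using t short_period_pos by (simp add: one_le_ceiling)
    moreover have "2 \<le> \<lceil>t / short_period j\<rceil>" if "2 * w + real j * d < t"
    proof -
      have "1 < t / short_period j"
        using that short_period_pos[of j] by (simp add: short_period_def)
      then show ?thesis by linarith
    qed
    ultimately have "1 + (if 2 * w + real j * d < t then 1 else 0) \<le> releases (short_task j) t"
      by (auto simp: releases_def short_task_def)
    from mult_right_mono[OF this, of d]
    show "d + (if 2 * w + real j * d < t then d else 0) \<le> releases (short_task j) t * d"
      using d by (simp add: algebra_simps split: if_splits)
  qed
  also have "\<dots> = (\<Sum>\<sigma>\<in>#mset load. releases \<sigma> t * wcet \<sigma>) - (3 * w - 1)"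
    unfolding sum_load by (simp add: short_task_def filler_def releases_def)
  finally show False using t d by (simp add: algebra_simps)
qed

section \<open>Hyperbolic test\<close>

text \<open>The execution time equals the spacing of the periods, so each factor 1 + d / T is the
  ratio of consecutive periods and the product telescopes.\<close>

lemma prod_util:
  "(\<Prod>\<sigma>\<in>#mset (short_tasks k). util \<sigma> + 1) = short_period (Suc k) / short_period 1"
proof (induction k)
  case 0
  then show ?case using short_period_pos[of 1] by (simp add: short_tasks_def)
next
  case (Suc k)
  have "(\<Prod>\<sigma>\<in>#mset (short_tasks (Suc k)). util \<sigma> + 1) =
      (\<Prod>\<sigma>\<in>#mset (short_tasks k). util \<sigma> + 1) * (util (short_task (Suc k)) + 1)"
    by (simp add: short_tasks_def)
  also have "util (short_task (Suc k)) + 1 = short_period (Suc (Suc k)) / short_period (Suc k)"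
    using short_period_pos[of "Suc k"]
    by (simp add: util_def short_task_def field_simps) (simp add: short_period_def algebra_simps)
  finally show ?case using short_period_pos[of "Suc k"] by (simp add: Suc)
qed

lemma deadline_simps:
  "deadline (short_task j) = short_period j" "deadline filler = 1" "deadline last_task = 1"
  by (simp_all add: short_task_def filler_def last_task_def)

lemma short_period_mono: "j \<le> k \<Longrightarrow> short_period j < short_period (Suc k)"
proof -
  assume "j \<le> k"
  then have "real j * d < real (Suc k) * d" using d by (intro mult_strict_right_mono) auto
  then show ?thesis by (simp add: short_period_def)
qed

text \<open>D is left general: it is the next short period while short tasks are added, and 1 for
  the filler and the last task.\<close>

lemma hyperbolic_sums:
  assumes "\<forall>j\<le>k. short_period j < D"
  shows "(\<Sum>\<sigma>\<in>#{#\<sigma> \<in># mset (short_tasks k). ereal D \<le> period \<sigma>#}. wcet \<sigma>) = 0"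
    and "(\<Prod>\<sigma>\<in>#{#\<sigma> \<in># mset (short_tasks k). period \<sigma> < ereal D#}. util \<sigma> + 1) =
      short_period (Suc k) / short_period 1"
proof -
  have *: "period \<sigma> < ereal D" if "\<sigma> \<in> set (short_tasks k)" for \<sigma>
    using that assms by (auto simp: short_tasks_def short_task_def simp del: upt_Suc)
  then have "{#\<sigma> \<in># mset (short_tasks k). ereal D \<le> period \<sigma>#} = {#}"
    by (auto simp: not_le)
  then show "(\<Sum>\<sigma>\<in>#{#\<sigma> \<in># mset (short_tasks k). ereal D \<le> period \<sigma>#}. wcet \<sigma>) = 0"
    by (simp only:) simp
  have "{#\<sigma> \<in># mset (short_tasks k). period \<sigma> < ereal D#} = mset (short_tasks k)"
    using * by (simp add: filter_mset_eq_conv)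
  then show "(\<Prod>\<sigma>\<in>#{#\<sigma> \<in># mset (short_tasks k). period \<sigma> < ereal D#}. util \<sigma> + 1) =
      short_period (Suc k) / short_period 1"
    by (simp only: prod_util)
qed

text \<open>For a short task the left-hand side is
  \<open>short_period (k + 2) / short_period 1\<close>, at most 1 / (2w) < 2; for the filler it is
  3w / (2w + d) < 3/2.\<close>

lemma hyperbolic_pass:
  assumes "k < length load"
  shows "hyperbolic_test (mset (take k load)) (load ! k)"
  using assms
proof (cases rule: load_cases)
  case 1
  have h: "\<forall>j\<le>k. short_period j < short_period (Suc k)" by (simp add: short_period_mono)
  have "(d / short_period (Suc k) + 1) * (short_period (Suc k) / short_period 1) =
      (short_period (Suc k) + d) / short_period 1"
    using short_period_pos[of "Suc k"] short_period_pos[of 1] by (simp add: field_simps)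
  also have "\<dots> \<le> 2"
    using short_period_pos[of 1] d_mult_le[of k] 1 w d
    by (simp add: field_simps) (simp add: short_period_def algebra_simps)
  finally show ?thesis
    unfolding 1(2,3) hyperbolic_test_def
    unfolding deadline_simps hyperbolic_sums[OF h] by (simp add: short_task_def)
next
  case 2
  have "(3 * w - 1 + 1) * (short_period (Suc N) / short_period 1) \<le> 2"
    using short_period_pos[of 1] w d
    by (simp add: field_simps) (simp add: short_period_def algebra_simps)
  then show ?thesis
    unfolding 2(2,3) hyperbolic_test_def
    unfolding deadline_simps hyperbolic_sums[OF short_periods_less_1] by (simp add: filler_def)
qed

text \<open>The left-hand side is (4w + g) / (2w + d), which exceeds 2 because g > 2d.\<close>

lemma hyperbolic_fail: "\<not> hyperbolic_test (mset load) last_task"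
proof -
  have "2 < (w + g + (3 * w - 1) + 1) * (short_period (Suc N) / short_period 1)"
    using short_period_pos[of 1] w d
    by (simp add: field_simps) (simp add: short_period_def algebra_simps)
  moreover have "(\<Sum>\<sigma>\<in>#{#\<sigma> \<in># mset load. ereal 1 \<le> period \<sigma>#}. wcet \<sigma>) = 3 * w - 1"
    using hyperbolic_sums(1)[OF short_periods_less_1] by (simp add: load_def filler_def)
  moreover have "(\<Prod>\<sigma>\<in>#{#\<sigma> \<in># mset load. period \<sigma> < ereal 1#}. util \<sigma> + 1) =
      short_period (Suc N) / short_period 1"
    using hyperbolic_sums(2)[OF short_periods_less_1] by (simp add: load_def filler_def)
  ultimately show ?thesis
    unfolding hyperbolic_test_def deadline_simps by (simp add: last_task_def)
qed

section \<open>Admissibility and the bound on Lambda\<close>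

lemma dm_indexed_copies_load: "0 < M \<Longrightarrow> dm_indexed_task_set (copies M load @ [last_task])"
proof -
  assume "0 < M"
  have "sorted_wrt (\<lambda>i j. short_period i \<le> short_period j) [1..<Suc N]"
    by (rule sorted_wrt_mono_rel[OF _ sorted_wrt_upt]) (use d in \<open>simp add: short_period_def\<close>)
  then have "sorted (map deadline load)"
    using short_period_bounds
    by (auto simp: load_def short_tasks_def sorted_append sorted_map sorted_wrt_map deadline_simps
          less_imp_le simp del: upt_Suc)
  moreover have "deadline \<tau> \<le> 1" "sporadic_task \<tau>" "constrained_deadline \<tau>" if "\<tau> \<in> set load" for \<tau>
    using that w d short_period_bounds short_period_pos
    by (auto simp: load_def short_tasks_def short_task_def filler_def sporadic_task_def
          constrained_deadline_def less_imp_le simp del: upt_Suc)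
  ultimately show ?thesis
    using \<open>0 < M\<close> w d
    by (auto simp: dm_indexed_task_set_def set_copies sorted_append sorted_map_copies
          last_task_def sporadic_task_def constrained_deadline_def)
qed

lemma sum_tasks: "(\<Sum>\<tau>\<in>#mset (copies M load @ [last_task]). f \<tau>) =
    real M * ((\<Sum>j = 1..N. f (short_task j)) + f filler) + f last_task"
proof -
  have "(\<Sum>\<tau>\<leftarrow>load. f \<tau>) = (\<Sum>\<tau>\<in>#mset load. f \<tau>)" by (metis mset_map sum_mset_sum_list)
  then show ?thesis using sum_mset_copies[of f M load] by (simp add: sum_load)
qed

text \<open>Implicit deadlines turn the demand of a short task into d \<lfloor>t / T\<rfloor>, so
  the floor sum estimate reduces the claim to its limiting form.\<close>

lemma load_dbf_le:
  assumes "0 < t"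
  shows "(\<Sum>j = 1..N. dbf (short_task j) t) + dbf filler t \<le> w * t"
proof -
  have "dbf (short_task j) t = d * \<lfloor>t / (2 * w + j * d)\<rfloor>" for j
  proof -
    have "(t - short_period j) / short_period j + 1 = t / short_period j"
      using short_period_pos[of j] by (simp add: field_simps)
    then have "\<lfloor>(t - short_period j) / short_period j\<rfloor> + 1 = \<lfloor>t / short_period j\<rfloor>"
      by (metis floor_add_int of_int_1)
    then show ?thesis
      using assms short_period_pos[of j] by (simp add: dbf_def short_task_def) (simp add: short_period_def)
  qed
  moreover have "dbf filler t = (if 1 \<le> t then 3 * w - 1 else 0)"
    by (simp add: dbf_def filler_def)
  moreover have "2 * w + real N * d \<le> 1" using d by (simp add: algebra_simps)
  ultimately show ?thesis
    using sum_floor_le_sum_min[of "2 * w" d t N] sum_min_le_linear[OF w assms] assms w d by simp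
qed

text \<open>From ln x <= x - 1, each d / s is at most ln s - ln (s - d). The sum telescopes to at
  most - ln (2w) = w.\<close>

lemma load_util_le: "(\<Sum>j = 1..N. util (short_task j)) \<le> w"
proof -
  have "(\<Sum>j = 1..N. util (short_task j)) \<le>
      (\<Sum>j = 1..N. ln (short_period j) - ln (short_period (j - 1)))"
  proof (rule sum_mono)
    fix j assume "j \<in> {1..N}"
    then have p: "short_period (j - 1) = short_period j - d"
      by (simp add: short_period_def of_nat_diff algebra_simps)
    have "ln (short_period (j - 1)) - ln (short_period j) \<le> short_period (j - 1) / short_period j - 1"
      using ln_le_minus_one[of "short_period (j - 1) / short_period j"]
        short_period_pos[of j] short_period_pos[of "j - 1"] by (simp add: ln_div)
    also have "\<dots> = - util (short_task j)"
      unfolding p using short_period_pos[of j] by (simp add: util_def short_task_def field_simps)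
    finally show "util (short_task j) \<le> ln (short_period j) - ln (short_period (j - 1))" by simp
  qed
  also have "\<dots> = ln (short_period N) - ln (short_period 0)"
    by (induction N) simp_all
  also have "\<dots> \<le> - ln (short_period 0)"
    using short_period_bounds[of N] by simp
  also have "short_period 0 = exp (- w)"
    using w by (simp add: short_period_def exp_minus field_simps)
  finally show ?thesis by simp
qed

text \<open>The hypothesis w + g <= M g absorbs the demand of the single last task into the margin
  g. Density reaches w + g only at that task.\<close>

lemma Lambda_le:
  assumes M: "0 < M" "w + g \<le> M * g"
  shows "Lambda M (mset (copies M load @ [last_task])) \<le> w + g"
proof -
  let ?ts = "copies M load @ [last_task]"
  have g: "0 < g" using d by simp
  have "(SUP t\<in>{0<..}. (\<Sum>\<tau>\<in>#mset ?ts. dbf \<tau> t) / (real M * t)) \<le> w + g"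
  proof (rule cSUP_least)
    fix t :: real assume "t \<in> {0<..}"
    then have t: "0 < t" by simp
    have "M * ((\<Sum>j = 1..N. dbf (short_task j) t) + dbf filler t) \<le> M * (w * t)"
      using load_dbf_le[OF t] by (intro mult_left_mono) auto
    moreover have "dbf last_task t \<le> M * (g * t)"
    proof (cases "1 \<le> t")
      case True
      have "w + g \<le> M * g" by (rule M)
      also have "M * g \<le> M * (g * t)" using True g by (intro mult_left_mono) auto
      finally show ?thesis using True by (simp add: dbf_def last_task_def)
    next
      case False
      then show ?thesis using t g by (simp add: dbf_def last_task_def)
    qed
    ultimately show "(\<Sum>\<tau>\<in>#mset ?ts. dbf \<tau> t) / (real M * t) \<le> w + g"
      unfolding sum_tasks using M t by (simp add: divide_le_eq algebra_simps)
  qed simp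
  moreover have "(\<Sum>\<tau>\<in>#mset ?ts. util \<tau>) / real M \<le> w + g"
  proof -
    have "util filler = 0" "util last_task = 0" by (simp_all add: util_def filler_def last_task_def)
    then show ?thesis unfolding sum_tasks using load_util_le M g by simp
  qed
  moreover have "Max (density ` set_mset (mset ?ts)) \<le> w + g"
  proof (rule Max.boundedI)
    fix x assume "x \<in> density ` set_mset (mset ?ts)"
    then obtain \<tau> where \<tau>: "\<tau> \<in> set ?ts" "x = density \<tau>" by auto
    then consider j where "j \<in> {1..N}" "\<tau> = short_task j" | "\<tau> = filler" | "\<tau> = last_task"
      using M by (fastforce simp: set_copies load_def short_tasks_def simp del: upt_Suc)
    then have "density \<tau> \<le> w + g"
    proof cases
      case 1
      \<comment> \<open>With d < g / 2 and short periods above 1/2, the density of a short task is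
        at most g.\<close>
      have "1 / 2 * g \<le> short_period j * g"
        using 1 short_period_bounds[of j] g by (intro mult_right_mono) auto
      then have "d \<le> g * short_period j" using d by (simp only: mult.commute)
      then have "d / short_period j \<le> g" using short_period_pos[of j] by (simp add: divide_le_eq)
      then show ?thesis using 1 w by (simp add: density_def util_def short_task_def)
    qed (use w g in \<open>auto simp: density_def util_def filler_def last_task_def\<close>)
    then show "x \<le> w + g" using \<tau> by simp
  qed auto
  ultimately show ?thesis unfolding Lambda_def by simp
qed

lemma dm_partition_fails:
  assumes "0 < M" "test \<in> {tda_test, hyperbolic_test}"
  shows "dm_partition test M spread_fit (copies M load @ [last_task]) = None"
proof -
  have "load \<noteq> []" by (simp add: load_def)
  then show ?thesis
    using assms distinct_load tda_pass tda_fail hyperbolic_pass hyperbolic_fail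
    by (auto intro!: dm_partition_copies_fails)
qed

end

section \<open>Choice of the parameters and the speedup bound\<close>

lemma failing_task_sets:
  assumes "0 < \<gamma>"
  shows "\<exists>M0. \<forall>M\<ge>M0. \<exists>ts. dm_indexed_task_set ts \<and>
     (\<forall>test\<in>{tda_test, hyperbolic_test}.
        \<exists>fit. fitting_strategy fit \<and> dm_partition test M fit ts = None) \<and>
     Lambda M (mset ts) \<le> lambert_W (1 / 2) + \<gamma>"
proof -
  obtain w where W: "lambert_W (1 / 2) = w" "w * exp w = 1 / 2"
    "1 / 2.843065 \<le> w" "w \<le> 1 / 2.843055"
    by (rule lambert_W_half_bounds)
  \<comment> \<open>This makes 2d < \<gamma>, so the instance can be taken with g = \<gamma>. One
    task set and one strategy then serve both tests.\<close>
  obtain N :: nat where N: "2 * (1 - 2 * w) / \<gamma> < N" using reals_Archimedean2 by blast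
  define d where "d = (1 - 2 * w) / (real N + 1)"
  interpret hard_instance w d \<gamma> N
  proof
    have "2 * (1 - 2 * w) < N * \<gamma>" using N assms by (simp add: field_simps)
    also have "\<dots> \<le> (real N + 1) * \<gamma>" using assms by simp
    finally show "2 * d < \<gamma>" by (simp add: d_def field_simps)
  qed (use W in \<open>auto simp: d_def field_simps\<close>)
  obtain K :: nat where K: "(w + \<gamma>) / \<gamma> < K" using reals_Archimedean2 by blast
  show ?thesis
  proof (intro exI[of _ "Suc K"] allI impI)
    fix M assume "Suc K \<le> M"
    then have M: "0 < M" "real K * \<gamma> \<le> M * \<gamma>" using assms by auto
    moreover have "w + \<gamma> < K * \<gamma>" using K assms by (simp add: field_simps)
    ultimately have "Lambda M (mset (copies M load @ [last_task])) \<le> lambert_W (1 / 2) + \<gamma>"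
      unfolding W(1) by (intro Lambda_le) auto
    then show "\<exists>ts. dm_indexed_task_set ts \<and>
       (\<forall>test\<in>{tda_test, hyperbolic_test}.
          \<exists>fit. fitting_strategy fit \<and> dm_partition test M fit ts = None) \<and>
       Lambda M (mset ts) \<le> lambert_W (1 / 2) + \<gamma>"
      by (intro exI[of _ "copies M load @ [last_task]"] exI[of _ spread_fit] conjI ballI
          dm_indexed_copies_load dm_partition_fails fitting_strategy_spread_fit M(1))
  qed
qed

theorem theorem9:
  "(\<forall>\<gamma>::real. \<gamma> > 0 \<longrightarrow>
      (\<exists>M0::nat. \<forall>M\<ge>M0. \<exists>ts. dm_indexed_task_set ts \<and>
         (\<forall>test\<in>{tda_test, hyperbolic_test}.
            \<exists>fit. fitting_strategy fit \<and> dm_partition test M fit ts = None) \<and>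
         Lambda M (mset ts) \<le> lambert_W (1 / 2) + \<gamma>))
   \<and> (\<forall>test\<in>{tda_test, hyperbolic_test}. \<forall>\<epsilon>::real. \<epsilon> > 0 \<longrightarrow>
      (\<exists>M0::nat. \<forall>M\<ge>M0. speedup_factor test M \<ge> ereal (1 / lambert_W (1 / 2) - \<epsilon>)))
   \<and> \<bar>1 / lambert_W (1 / 2) - 2.84306\<bar> \<le> 0.000005"
proof (intro conjI allI impI ballI)
  obtain w where w: "lambert_W (1 / 2) = w" "w * exp w = 1 / 2"
    "1 / 2.843065 \<le> w" "w \<le> 1 / 2.843055"
    by (rule lambert_W_half_bounds)
  then have "0 < w" by simp
  show "\<bar>1 / lambert_W (1 / 2) - 2.84306\<bar> \<le> 0.000005"
  proof -
    have "1 / w \<le> 2.843065" "2.843055 \<le> 1 / w" using w(3,4) \<open>0 < w\<close> by (simp_all add: field_simps)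
    moreover have "\<bar>v - 2.84306\<bar> \<le> 0.000005" if "v \<le> 2.843065" "2.843055 \<le> v" for v :: real
      using that by (intro abs_leI) simp_all
    ultimately show ?thesis unfolding w(1) by blast
  qed
  fix test and \<epsilon> :: real
  assume test: "test \<in> {tda_test, hyperbolic_test}" and \<epsilon>: "0 < \<epsilon>"
  \<comment> \<open>The margin \<epsilon> w^2 is the first-order loss that moves 1 / w down by
    \<epsilon>: (1/w - \<epsilon>) r = 1 - (\<epsilon> w)^2 <= 1.\<close>
  define r where "r = w + \<epsilon> * w\<^sup>2"
  have r: "0 < r" using \<open>0 < w\<close> \<epsilon> by (simp add: r_def add_pos_pos)
  have "(1 / w - \<epsilon>) * r = 1 - (\<epsilon> * w)\<^sup>2"
    using \<open>0 < w\<close> by (simp add: r_def field_simps power2_eq_square)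
  then have "(1 / w - \<epsilon>) * r \<le> 1" by simp
  then have r': "1 / w - \<epsilon> \<le> 1 / r" using r by (simp add: le_divide_eq)
  have "0 < \<epsilon> * w\<^sup>2" using \<open>0 < w\<close> \<epsilon> by simp
  then obtain M0 where M0: "\<forall>M\<ge>M0. \<exists>ts. dm_indexed_task_set ts \<and>
     (\<forall>test\<in>{tda_test, hyperbolic_test}.
        \<exists>fit. fitting_strategy fit \<and> dm_partition test M fit ts = None) \<and>
     Lambda M (mset ts) \<le> r"
    using failing_task_sets[of "\<epsilon> * w\<^sup>2"] unfolding w(1) r_def[symmetric] by (metis (no_types, lifting))
  have "ereal (1 / w - \<epsilon>) \<le> speedup_factor test M" if "M0 \<le> M" for M
  proof -
    have "ereal (1 / r) \<le> speedup_factor test M"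
      using M0 that test speedup_factor_ge[OF r] by blast
    then show ?thesis using r' by (meson ereal_less_eq(3) order_trans)
  qed
  then show "\<exists>M0. \<forall>M\<ge>M0. ereal (1 / lambert_W (1 / 2) - \<epsilon>) \<le> speedup_factor test M"
    unfolding w(1) by blast
qed (use failing_task_sets in blast)

end
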